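(* Let $(\Lambda,\Lambda^{[2]},\mu)$ be a categorical Exel semigroupoid, endowed with a graph structure $(\Lambda^{(0)},\Lambda,\mathfrak{s},\mathfrak{r})$ with $\Lambda^{[2]}=\Lambda^{(2)}$ which makes it a graphed semigroupoid $(\Lambda^{(0)},\Lambda,\mathfrak{s},\mathfrak{r},\mu)$. Suppose moreover that $\Lambda^{(0)}=\mathfrak{s}(\Lambda)\cup\mathfrak{r}(\Lambda)$. Then there exist unique equivalence relations $R_0$ on $V_0$ and $R_1$ on $V_1$, satisfying condition $(\ast)$ of the context, for which there exists a bijection $I\colon\Lambda^{(0)}_{R_0,R_1}\to\Lambda^{(0)}$ such that $(I,\mathrm{id}_\Lambda)$ is a graph isomorphism from $(\Lambda^{(0)}_{R_0,R_1},\Lambda,\mathfrak{s}_{R_0,R_1},\mathfrak{r}_{R_0,R_1})$ to $(\Lambda^{(0)},\Lambda,\mathfrak{s},\mathfrak{r})$.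
   Context: An Exel semigroupoid is a set $\Lambda$ with $\Lambda^{[2]}\subseteq\Lambda\times\Lambda$ and a product $\mu\colon\Lambda^{[2]}\to\Lambda$, $\mu(f,g)=fg$, such that for all $f,g,h\in\Lambda$ the statements (i) $(f,g),(g,h)\in\Lambda^{[2]}$; (ii) $(f,g),(fg,h)\in\Lambda^{[2]}$; (iii) $(g,h),(f,gh)\in\Lambda^{[2]}$ are equivalent, and if they hold then $(fg)h=f(gh)$. Put $\Lambda^a=\{b:(a,b)\in\Lambda^{[2]}\}$ and $\Lambda_a=\{b:(b,a)\in\Lambda^{[2]}\}$. $\Lambda$ is categorical if for all $a,b$, $\Lambda^a$ and $\Lambda^b$ are disjoint or equal (equivalently, for all $a,b$, $\Lambda_a$ and $\Lambda_b$ are disjoint or equal). A graph consists of a vertex set $G^{(0)}$, an arrow set $G$ and maps $\mathfrak{s},\mathfrak{r}\colon G\to G^{(0)}$; $G^{(2)}=\{(a,b):\mathfrak{s}(a)=\mathfrak{r}(b)\}$. A graphed semigroupoid is a graph $(\mathcal{S}^{(0)},\mathcal{S},\mathfrak{s},\mathfrak{r})$ with a map $\mathcal{S}^{(2)}\to\mathcal{S}$, $(a,b)\mapsto ab$, with $\mathfrak{s}(ab)=\mathfrak{s}(b)$, $\mathfrak{r}(ab)=\mathfrak{r}(a)$ and $(ab)c=a(bc)$ whenever $(a,b),(b,c)\in\mathcal{S}^{(2)}$. A graph isomorphism from $G$ to $H$ is a pair $(\phi^{(0)},\phi)$ of bijections $\phi^{(0)}\colon G^{(0)}\to H^{(0)}$,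 $\phi\colon G\to H$ with $\mathfrak{s}_H\circ\phi=\phi^{(0)}\circ\mathfrak{s}_G$ and $\mathfrak{r}_H\circ\phi=\phi^{(0)}\circ\mathfrak{r}_G$. Given a categorical $\Lambda$, let $V_0=\{v_0(a):a\in\Lambda,\Lambda^a=\varnothing\}$ and $V_1=\{v_1(a):a\in\Lambda,\Lambda_a=\varnothing\}$ be two sets of formal symbols (distinct $a$ give distinct symbols). Let $R_0,R_1$ be equivalence relations on $V_0,V_1$ satisfying, for all $(a,b)\in\Lambda^{[2]}$: $(\ast)$ if $\Lambda^b=\varnothing$ then $(v_0(b),v_0(ab))\in R_0$; and if $\Lambda_a=\varnothing$ then $(v_1(a),v_1(ab))\in R_1$. (Note $\Lambda^{ab}=\Lambda^b$ and $\Lambda_{ab}=\Lambda_a$.) Write $[v_i(a)]$ for the $R_i$-class of $v_i(a)$. Define $\Lambda^{(0)}_{R_0,R_1}$ as the disjoint union $\{\Lambda_a:a\in\Lambda,\Lambda_a\neq\varnothing\}\sqcup(V_0/R_0)\sqcup(V_1/R_1)$, and $\mathfrak{s}_{R_0,R_1}(a)=\Lambda_z$ for any $z\in\Lambda^a$ if $\Lambda^a\neq\varnothing$ (well defined since $\Lambda$ is categorical), and $\mathfrak{s}_{R_0,R_1}(a)=[v_0(a)]$ if $\Lambda^a=\varnothing$; $\mathfrak{r}_{R_0,R_1}(a)=\Lambda_a$ if $\Lambda_a\neq\varnothing$, and $\mathfrak{r}_{R_0,R_1}(a)=[v_1(a)]$ if $\Lambda_a=\varnothing$. *)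

theory Defs
  imports "Graph_Theory.Digraph"
begin

locale exel_semigroupoid =
  fixes \<Lambda> :: "'a set"
    and comp :: "('a \<times> 'a) set"
    and mult :: "'a \<Rightarrow> 'a \<Rightarrow> 'a"
  assumes comp_subset: "comp \<subseteq> \<Lambda> \<times> \<Lambda>"
    and mult_closed: "(f, g) \<in> comp \<Longrightarrow> mult f g \<in> \<Lambda>"
    and comp_iff_left: "\<lbrakk>f \<in> \<Lambda>; g \<in> \<Lambda>; h \<in> \<Lambda>\<rbrakk> \<Longrightarrow>
      (f, g) \<in> comp \<and> (g, h) \<in> comp \<longleftrightarrow> (f, g) \<in> comp \<and> (mult f g, h) \<in> comp"
    and comp_iff_right: "\<lbrakk>f \<in> \<Lambda>; g \<in> \<Lambda>; h \<in> \<Lambda>\<rbrakk> \<Longrightarrow>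
      (f, g) \<in> comp \<and> (g, h) \<in> comp \<longleftrightarrow> (g, h) \<in> comp \<and> (f, mult g h) \<in> comp"
    and mult_assoc: "\<lbrakk>f \<in> \<Lambda>; g \<in> \<Lambda>; h \<in> \<Lambda>; (f, g) \<in> comp; (g, h) \<in> comp\<rbrakk> \<Longrightarrow>
      mult (mult f g) h = mult f (mult g h)"

text \<open>The sets \<open>\<Lambda>\<^sup>a\<close> (elements that may follow \<open>a\<close> on the right) and \<open>\<Lambda>\<^sub>a\<close>
  (elements that may precede \<open>a\<close> on the left).\<close>

definition rcomp :: "('a \<times> 'a) set \<Rightarrow> 'a \<Rightarrow> 'a set" where
  "rcomp C a = {b. (a, b) \<in> C}"

definition lcomp :: "('a \<times> 'a) set \<Rightarrow> 'a \<Rightarrow> 'a set" where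
  "lcomp C a = {b. (b, a) \<in> C}"

locale categorical_exel_semigroupoid = exel_semigroupoid +
  assumes categorical: "\<lbrakk>a \<in> \<Lambda>; b \<in> \<Lambda>\<rbrakk> \<Longrightarrow>
    rcomp comp a \<inter> rcomp comp b = {} \<or> rcomp comp a = rcomp comp b"

text \<open>Graphs are \<open>wf_digraph\<close>s: the source map \<open>\<s>\<close> is \<^const>\<open>tail\<close> and
  the range map \<open>\<r>\<close> is \<^const>\<open>head\<close>.\<close>

definition composable :: "('v, 'a) pre_digraph \<Rightarrow> ('a \<times> 'a) set" where
  "composable G = {(a, b). a \<in> arcs G \<and> b \<in> arcs G \<and> tail G a = head G b}"

locale graphed_semigroupoid = wf_digraph G
  for G :: "('v, 'a) pre_digraph" +
  fixes mult :: "'a \<Rightarrow> 'a \<Rightarrow> 'a"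
  assumes mult_in_arcs: "(a, b) \<in> composable G \<Longrightarrow> mult a b \<in> arcs G"
    and tail_mult: "(a, b) \<in> composable G \<Longrightarrow> tail G (mult a b) = tail G b"
    and head_mult: "(a, b) \<in> composable G \<Longrightarrow> head G (mult a b) = head G a"
    and mult_assoc: "\<lbrakk>(a, b) \<in> composable G; (b, c) \<in> composable G\<rbrakk> \<Longrightarrow>
      mult (mult a b) c = mult a (mult b c)"

text \<open>The library's \<open>digraph_iso\<close> demands equality of the underlying records, hence also
  of the values of \<^const>\<open>tail\<close> and \<^const>\<open>head\<close> outside the set of arcs; the following
  notion only constrains them on arcs.\<close>

definition graph_isomorphism ::
  "('v \<Rightarrow> 'w) \<Rightarrow> ('a \<Rightarrow> 'b) \<Rightarrow> ('v, 'a) pre_digraph \<Rightarrow> ('w, 'b) pre_digraph \<Rightarrow> bool" where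
  "graph_isomorphism \<phi>0 \<phi> G H \<longleftrightarrow>
     wf_digraph G \<and> wf_digraph H \<and>
     bij_betw \<phi>0 (verts G) (verts H) \<and> bij_betw \<phi> (arcs G) (arcs H) \<and>
     (\<forall>a \<in> arcs G. tail H (\<phi> a) = \<phi>0 (tail G a)) \<and>
     (\<forall>a \<in> arcs G. head H (\<phi> a) = \<phi>0 (head G a))"

datatype 'a symbol = v0 'a | v1 'a

definition V0 :: "'a set \<Rightarrow> ('a \<times> 'a) set \<Rightarrow> 'a symbol set" where
  "V0 \<Lambda> C = {v0 a | a. a \<in> \<Lambda> \<and> rcomp C a = {}}"

definition V1 :: "'a set \<Rightarrow> ('a \<times> 'a) set \<Rightarrow> 'a symbol set" where
  "V1 \<Lambda> C = {v1 a | a. a \<in> \<Lambda> \<and> lcomp C a = {}}"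

text \<open>Condition \<open>(\<ast>)\<close>.\<close>

definition mult_compatible ::
  "('a \<times> 'a) set \<Rightarrow> ('a \<Rightarrow> 'a \<Rightarrow> 'a) \<Rightarrow> 'a symbol rel \<Rightarrow> 'a symbol rel \<Rightarrow> bool" where
  "mult_compatible C mult R0 R1 \<longleftrightarrow>
     (\<forall>(a, b) \<in> C. (rcomp C b = {} \<longrightarrow> (v0 b, v0 (mult a b)) \<in> R0) \<and>
                   (lcomp C a = {} \<longrightarrow> (v1 a, v1 (mult a b)) \<in> R1))"

type_synonym 'a canonical_vertex = "'a set + 'a symbol set + 'a symbol set"

definition canonical_source ::
  "('a \<times> 'a) set \<Rightarrow> 'a symbol rel \<Rightarrow> 'a \<Rightarrow> 'a canonical_vertex" where
  "canonical_source C R0 a =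
     (if rcomp C a \<noteq> {} then Inl (lcomp C (SOME z. z \<in> rcomp C a))
      else Inr (Inl (R0 `` {v0 a})))"

definition canonical_range ::
  "('a \<times> 'a) set \<Rightarrow> 'a symbol rel \<Rightarrow> 'a \<Rightarrow> 'a canonical_vertex" where
  "canonical_range C R1 a =
     (if lcomp C a \<noteq> {} then Inl (lcomp C a) else Inr (Inr (R1 `` {v1 a})))"

definition canonical_graph ::
  "'a set \<Rightarrow> ('a \<times> 'a) set \<Rightarrow> 'a symbol rel \<Rightarrow> 'a symbol rel
    \<Rightarrow> ('a canonical_vertex, 'a) pre_digraph" where
  "canonical_graph \<Lambda> C R0 R1 =
     \<lparr> verts = {lcomp C a | a. a \<in> \<Lambda> \<and> lcomp C a \<noteq> {}} <+> (V0 \<Lambda> C // R0) <+> (V1 \<Lambda> C // R1),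
       arcs = \<Lambda>,
       tail = canonical_source C R0,
       head = canonical_range C R1 \<rparr>"

text \<open>The choice of \<open>z\<close> in \<^const>\<open>canonical_source\<close> is immaterial.\<close>

lemma (in categorical_exel_semigroupoid) canonical_source_eq:
  assumes "z \<in> rcomp comp a"
  shows "canonical_source comp R0 a = Inl (lcomp comp z)"
proof -
  have *: "lcomp comp x \<subseteq> lcomp comp y" if "x \<in> rcomp comp a" "y \<in> rcomp comp a" for x y
  proof
    fix c assume "c \<in> lcomp comp x"
    then have "x \<in> rcomp comp c" by (simp add: lcomp_def rcomp_def)
    moreover have "a \<in> \<Lambda>" "c \<in> \<Lambda>"
      using that comp_subset \<open>x \<in> rcomp comp c\<close> by (auto simp: rcomp_def)
    ultimately have "rcomp comp c = rcomp comp a" using categorical that(1) by blast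
    then show "c \<in> lcomp comp y" using that(2) by (auto simp: lcomp_def rcomp_def)
  qed
  have "(SOME z. z \<in> rcomp comp a) \<in> rcomp comp a" using assms by (rule someI)
  then have "lcomp comp (SOME z. z \<in> rcomp comp a) = lcomp comp z"
    using * assms by blast
  then show ?thesis using assms by (auto simp: canonical_source_def)
qed

end

theory Submission
  imports Defs
begin

text \<open>A graph without isolated vertices is determined, up to relabelling its vertices, by which
  ends of its arcs coincide: call the two ends of each arc half-arcs; the vertices are then the
  classes of half-arcs under the relation ``same end point''
  (\<open>isomorphic_over_arcs_iff\<close>).  So it suffices to compare coincidences in \<open>G\<close> and in the
  canonical graph.

  Most of them agree, whatever \<open>R\<^sub>0\<close> and \<open>R\<^sub>1\<close> are.  A source meets a range exactly when the
  two arcs are composable.  A vertex at which some composable pair meets is recovered from the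
  nonempty set of arcs with that source, and this set is its canonical name \<open>\<Lambda>\<^sub>z\<close>.
  What remains are coincidences between two sources that are not ranges, or between two ranges that
  are not sources; there the canonical graph identifies end points according to \<open>R\<^sub>0\<close> and
  \<open>R\<^sub>1\<close>.  Hence the graphs are isomorphic if and only if these are the relations ``same source''
  and ``same range'' on the symbols (\<open>canonical_graph_isomorphic_iff\<close>), which gives existence
  and uniqueness together.  The two relations satisfy \<open>(\<ast>)\<close> because the product \<open>ab\<close>
  has the source of \<open>b\<close> and the range of \<open>a\<close>.\<close>

section \<open>Graphs without isolated vertices\<close>

text \<open>The summands \<open>Inl a\<close> and \<open>Inr a\<close> are the two half-arcs of \<open>a\<close>.\<close>

fun endpoint :: "('v, 'a) pre_digraph \<Rightarrow> 'a + 'a \<Rightarrow> 'v" where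
  "endpoint G (Inl a) = tail G a"
| "endpoint G (Inr a) = head G a"

definition no_isolated_vertices :: "('v, 'a) pre_digraph \<Rightarrow> bool" where
  "no_isolated_vertices G \<longleftrightarrow> verts G = endpoint G ` (arcs G <+> arcs G)"

lemma no_isolated_vertices_iff:
  "no_isolated_vertices G \<longleftrightarrow> verts G = tail G ` arcs G \<union> head G ` arcs G"
  by (simp add: no_isolated_vertices_def Plus_def image_Un image_image)

lemma no_isolated_vertices_imp_wf: "no_isolated_vertices G \<Longrightarrow> wf_digraph G"
  by unfold_locales (auto simp: no_isolated_vertices_iff)

text \<open>The image of a map is the quotient of its domain by the kernel relation, so equal kernels
  mean bijective images.\<close>

lemma ex_bij_betw_images_iff:
  "(\<exists>I. bij_betw I (f ` A) (g ` A) \<and> (\<forall>x\<in>A. g x = I (f x))) \<longleftrightarrow>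
   (\<forall>x\<in>A. \<forall>y\<in>A. f x = f y \<longleftrightarrow> g x = g y)"
  (is "?L \<longleftrightarrow> ?R")
proof
  assume ?L
  then obtain I where "inj_on I (f ` A)" "\<And>x. x \<in> A \<Longrightarrow> g x = I (f x)"
    by (auto simp: bij_betw_def)
  then show ?R by (simp add: inj_on_eq_iff)
next
  assume R: ?R
  define I where "I v = g (inv_into A f v)" for v
  have I: "g x = I (f x)" if "x \<in> A" for x
  proof -
    have inv: "inv_into A f (f x) \<in> A" "f (inv_into A f (f x)) = f x"
      using that by (simp_all add: inv_into_into f_inv_into_f)
    from iffD1[OF R[rule_format, OF inv(1) that] inv(2)] show ?thesis by (simp only: I_def)
  qed
  have "inj_on I (f ` A)"
  proof (rule inj_onI)
    fix v w assume "v \<in> f ` A" "w \<in> f ` A" "I v = I w"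
    then obtain x y where xy: "x \<in> A" "y \<in> A" "v = f x" "w = f y" by blast
    with \<open>I v = I w\<close> have "g x = g y" by (simp only: I)
    with R[rule_format, OF xy(1,2)] xy show "v = w" by simp
  qed
  moreover have "I ` f ` A = g ` A"
    unfolding image_image using I by (intro image_cong) simp_all
  ultimately have "bij_betw I (f ` A) (g ` A)" by (simp add: bij_betw_def)
  with I show ?L by blast
qed

text \<open>On graphs without isolated vertices the vertex map of an isomorphism that fixes all arcs has no
  choice: it sends the end point of a half-arc in one graph to its end point in the other.
  Coinciding end points are what makes this map well defined and injective.\<close>

lemma isomorphic_over_arcs_iff:
  assumes "no_isolated_vertices G" "no_isolated_vertices H" "arcs G = arcs H"
  shows "(\<exists>I. graph_isomorphism I id G H) \<longleftrightarrow>
    (\<forall>x \<in> arcs G <+> arcs G. \<forall>y \<in> arcs G <+> arcs G.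
      endpoint G x = endpoint G y \<longleftrightarrow> endpoint H x = endpoint H y)"
proof -
  let ?E = "arcs G <+> arcs G"
  have arcs: "(\<forall>x\<in>?E. endpoint H x = I (endpoint G x)) \<longleftrightarrow>
      (\<forall>a\<in>arcs G. tail H a = I (tail G a)) \<and> (\<forall>a\<in>arcs G. head H a = I (head G a))" for I
    by (simp add: Plus_def ball_Un)
  have "graph_isomorphism I id G H \<longleftrightarrow>
      bij_betw I (endpoint G ` ?E) (endpoint H ` ?E) \<and>
      (\<forall>x\<in>?E. endpoint H x = I (endpoint G x))" for I
  proof -
    have "wf_digraph G" "wf_digraph H"
      using assms(1,2) by (simp_all add: no_isolated_vertices_imp_wf)
    moreover have "verts G = endpoint G ` ?E" "verts H = endpoint H ` ?E"
      using assms by (simp_all add: no_isolated_vertices_def)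
    ultimately show ?thesis
      unfolding arcs graph_isomorphism_def by (simp only: assms(3) bij_betw_id id_apply simp_thms)
  qed
  then show ?thesis by (simp only: ex_bij_betw_images_iff)
qed

section \<open>Coincidences in the canonical graph\<close>

lemma lcomp_composable: "b \<in> arcs G \<Longrightarrow> lcomp (composable G) b = out_arcs G (head G b)"
  by (auto simp: lcomp_def composable_def)

lemma rcomp_composable: "a \<in> arcs G \<Longrightarrow> rcomp (composable G) a = in_arcs G (tail G a)"
  by (auto simp: rcomp_def composable_def)

lemma out_arcs_tail_nonempty: "a \<in> arcs G \<Longrightarrow> out_arcs G (tail G a) \<noteq> {}"
  by auto

lemma in_arcs_head_nonempty: "b \<in> arcs G \<Longrightarrow> in_arcs G (head G b) \<noteq> {}"
  by auto

text \<open>This is why a vertex that is the source of some arc can be replaced by the set of arcs that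
  start there.\<close>

lemma out_arcs_eq_iff: "out_arcs G u \<noteq> {} \<Longrightarrow> out_arcs G u = out_arcs G v \<longleftrightarrow> u = v"
  by (auto simp: out_arcs_def)

lemma canonical_source_composable:
  assumes "a \<in> arcs G"
  shows "canonical_source (composable G) R a =
    (if in_arcs G (tail G a) \<noteq> {} then Inl (out_arcs G (tail G a))
     else Inr (Inl (R `` {v0 a})))"
proof (cases "in_arcs G (tail G a) = {}")
  case False
  then have "(SOME z. z \<in> in_arcs G (tail G a)) \<in> in_arcs G (tail G a)"
    unfolding some_in_eq .
  moreover have "lcomp (composable G) z = out_arcs G (tail G a)" if "z \<in> in_arcs G (tail G a)" for z
    using that by (simp add: lcomp_composable)
  ultimately show ?thesis
    using False assms
    by (simp only: canonical_source_def rcomp_composable if_True not_False_eq_True)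
next
  case True
  with assms show ?thesis by (simp add: canonical_source_def rcomp_composable)
qed

lemma canonical_range_composable:
  assumes "b \<in> arcs G"
  shows "canonical_range (composable G) R b =
    (if out_arcs G (head G b) \<noteq> {} then Inl (out_arcs G (head G b))
     else Inr (Inr (R `` {v1 b})))"
  using assms by (simp add: canonical_range_def lcomp_composable)

text \<open>If the vertices coincide, then \<open>a\<close> and \<open>b\<close> are composable, so neither of them is
  named by a symbol.  Conversely, symbols of the two kinds are never equal, and nonempty sets of outgoing arcs
  determine their vertex.\<close>

lemma canonical_source_eq_range_iff:
  assumes "a \<in> arcs G" "b \<in> arcs G"
  shows "canonical_source (composable G) R0 a = canonical_range (composable G) R1 b \<longleftrightarrow>
    tail G a = head G b"
proof (cases "tail G a = head G b")
  case True
  with assms have "in_arcs G (tail G a) \<noteq> {}" "out_arcs G (head G b) \<noteq> {}"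
    using out_arcs_tail_nonempty[of a G] in_arcs_head_nonempty[of b G] by simp_all
  with True assms show ?thesis by (simp add: canonical_source_composable canonical_range_composable)
next
  case False
  then show ?thesis
    using assms out_arcs_eq_iff[OF out_arcs_tail_nonempty[of a G]]
    by (simp add: canonical_source_composable canonical_range_composable)
qed

text \<open>Whether \<open>\<Lambda>\<^sup>a\<close> is empty depends only on the source of \<open>a\<close>.  So arcs with the
  same source have sources of the same canonical kind, and \<open>R\<close> matters only when both are
  symbols.  The lemma for ranges is dual.\<close>

lemma canonical_source_eq_iff:
  assumes "equiv (V0 (arcs G) (composable G)) R" "a \<in> arcs G" "b \<in> arcs G"
  shows "canonical_source (composable G) R a = canonical_source (composable G) R b \<longleftrightarrow>
    (if rcomp (composable G) a = {} \<and> rcomp (composable G) b = {} then (v0 a, v0 b) \<in> R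
     else tail G a = tail G b)"
proof (cases "rcomp (composable G) a = {} \<and> rcomp (composable G) b = {}")
  case True
  then have "R `` {v0 a} = R `` {v0 b} \<longleftrightarrow> (v0 a, v0 b) \<in> R"
    using assms by (intro eq_equiv_class_iff[OF assms(1)]) (auto simp: V0_def)
  with True show ?thesis by (simp add: canonical_source_def)
next
  case False
  then show ?thesis
    using assms(2,3) out_arcs_eq_iff[OF out_arcs_tail_nonempty[of a G]]
    by (cases "tail G a = tail G b") (simp_all add: canonical_source_composable rcomp_composable)
qed

lemma canonical_range_eq_iff:
  assumes "equiv (V1 (arcs G) (composable G)) R" "a \<in> arcs G" "b \<in> arcs G"
  shows "canonical_range (composable G) R a = canonical_range (composable G) R b \<longleftrightarrow>
    (if lcomp (composable G) a = {} \<and> lcomp (composable G) b = {} then (v1 a, v1 b) \<in> R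
     else head G a = head G b)"
proof (cases "lcomp (composable G) a = {} \<and> lcomp (composable G) b = {}")
  case True
  then have "R `` {v1 a} = R `` {v1 b} \<longleftrightarrow> (v1 a, v1 b) \<in> R"
    using assms by (intro eq_equiv_class_iff[OF assms(1)]) (auto simp: V1_def)
  with True show ?thesis by (simp add: canonical_range_def)
next
  case False
  then show ?thesis
    using assms(2,3) out_arcs_eq_iff[of G "head G a" "head G b"]
    by (cases "head G a = head G b") (simp_all add: canonical_range_composable lcomp_composable)
qed

text \<open>A set \<open>\<Lambda>\<^sub>a\<close> or a class of \<open>v1 a\<close> is the range of \<open>a\<close>, and a class of
  \<open>v0 a\<close> is its source.\<close>

lemma canonical_graph_no_isolated_vertices:
  "no_isolated_vertices (canonical_graph (arcs G) (composable G) R0 R1)"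
  (is "no_isolated_vertices ?C")
proof -
  let ?\<Lambda> = "arcs G" and ?K = "composable G"
  have "verts ?C \<subseteq> tail ?C ` ?\<Lambda> \<union> head ?C ` ?\<Lambda>"
  proof
    fix v assume "v \<in> verts ?C"
    then consider a where "a \<in> ?\<Lambda>" "lcomp ?K a \<noteq> {}" "v = Inl (lcomp ?K a)"
      | a where "a \<in> ?\<Lambda>" "rcomp ?K a = {}" "v = Inr (Inl (R0 `` {v0 a}))"
      | a where "a \<in> ?\<Lambda>" "lcomp ?K a = {}" "v = Inr (Inr (R1 `` {v1 a}))"
      by (auto simp: canonical_graph_def V0_def V1_def quotient_def)
    then show "v \<in> tail ?C ` ?\<Lambda> \<union> head ?C ` ?\<Lambda>"
    proof cases
      case 1 then have "v = head ?C a" by (simp add: canonical_graph_def canonical_range_def)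
      with 1 show ?thesis by blast
    next
      case 2 then have "v = tail ?C a" by (simp add: canonical_graph_def canonical_source_def)
      with 2 show ?thesis by blast
    next
      case 3 then have "v = head ?C a" by (simp add: canonical_graph_def canonical_range_def)
      with 3 show ?thesis by blast
    qed
  qed
  moreover have head_vert: "head ?C a \<in> verts ?C" if "a \<in> ?\<Lambda>" for a
    using that by (auto simp: canonical_graph_def canonical_range_def V1_def intro: quotientI)
  moreover have "tail ?C a \<in> verts ?C" if a: "a \<in> ?\<Lambda>" for a
  proof (cases "rcomp ?K a = {}")
    case True
    then show ?thesis
      using a by (auto simp: canonical_graph_def canonical_source_def V0_def intro: quotientI)
  next
    case False
    then obtain z where z: "(a, z) \<in> ?K" by (auto simp: rcomp_def)
    then have "z \<in> ?\<Lambda>" "tail G a = head G z" by (auto simp: composable_def)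
    then have "tail ?C a = head ?C z"
      using canonical_source_eq_range_iff[OF a] by (simp add: canonical_graph_def)
    with head_vert[OF \<open>z \<in> ?\<Lambda>\<close>] show ?thesis by simp
  qed
  ultimately show ?thesis by (auto simp: no_isolated_vertices_iff canonical_graph_def)
qed

section \<open>The relations determined by the graph\<close>

definition same_source :: "('v, 'a) pre_digraph \<Rightarrow> 'a symbol rel" where
  "same_source G = {(v0 a, v0 b) | a b.
     a \<in> arcs G \<and> rcomp (composable G) a = {} \<and> b \<in> arcs G \<and> rcomp (composable G) b = {} \<and>
     tail G a = tail G b}"

definition same_range :: "('v, 'a) pre_digraph \<Rightarrow> 'a symbol rel" where
  "same_range G = {(v1 a, v1 b) | a b.
     a \<in> arcs G \<and> lcomp (composable G) a = {} \<and> b \<in> arcs G \<and> lcomp (composable G) b = {} \<and>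
     head G a = head G b}"

lemma equiv_same_source: "equiv (V0 (arcs G) (composable G)) (same_source G)"
  by (rule equivI) (auto simp: same_source_def V0_def refl_on_def sym_def trans_def)

lemma equiv_same_range: "equiv (V1 (arcs G) (composable G)) (same_range G)"
  by (rule equivI) (auto simp: same_range_def V1_def refl_on_def sym_def trans_def)

lemma eq_same_source_iff:
  assumes "equiv (V0 (arcs G) (composable G)) R"
  shows "R = same_source G \<longleftrightarrow> (\<forall>a \<in> arcs G. \<forall>b \<in> arcs G.
    rcomp (composable G) a = {} \<and> rcomp (composable G) b = {} \<longrightarrow>
    ((v0 a, v0 b) \<in> R \<longleftrightarrow> tail G a = tail G b))"
    (is "_ \<longleftrightarrow> ?P")
proof
  assume P: ?P
  have "R \<subseteq> V0 (arcs G) (composable G) \<times> V0 (arcs G) (composable G)"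
    using assms by (rule equiv_type)
  then have "R \<subseteq> same_source G" using P by (auto simp: same_source_def V0_def)
  moreover have "same_source G \<subseteq> R" using P by (auto simp: same_source_def)
  ultimately show "R = same_source G" ..
qed (auto simp: same_source_def)

lemma eq_same_range_iff:
  assumes "equiv (V1 (arcs G) (composable G)) R"
  shows "R = same_range G \<longleftrightarrow> (\<forall>a \<in> arcs G. \<forall>b \<in> arcs G.
    lcomp (composable G) a = {} \<and> lcomp (composable G) b = {} \<longrightarrow>
    ((v1 a, v1 b) \<in> R \<longleftrightarrow> head G a = head G b))"
    (is "_ \<longleftrightarrow> ?P")
proof
  assume P: ?P
  have "R \<subseteq> V1 (arcs G) (composable G) \<times> V1 (arcs G) (composable G)"
    using assms by (rule equiv_type)
  then have "R \<subseteq> same_range G" using P by (auto simp: same_range_def V1_def)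
  moreover have "same_range G \<subseteq> R" using P by (auto simp: same_range_def)
  ultimately show "R = same_range G" ..
qed (auto simp: same_range_def)

text \<open>An equivalence proves existence and uniqueness of \<open>R\<^sub>0\<close> and \<open>R\<^sub>1\<close> at once: the
  coincidences that they control must be those of \<open>G\<close>, and all others agree anyway.\<close>

lemma canonical_graph_isomorphic_iff:
  assumes "no_isolated_vertices G"
    and R0: "equiv (V0 (arcs G) (composable G)) R0"
    and R1: "equiv (V1 (arcs G) (composable G)) R1"
  shows "(\<exists>I. graph_isomorphism I id (canonical_graph (arcs G) (composable G) R0 R1) G) \<longleftrightarrow>
    R0 = same_source G \<and> R1 = same_range G"
proof -
  let ?\<Lambda> = "arcs G" and ?K = "composable G" and ?C = "canonical_graph (arcs G) (composable G) R0 R1"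
  have tail: "tail ?C = canonical_source ?K R0" and head: "head ?C = canonical_range ?K R1"
    and arcs: "arcs ?C = ?\<Lambda>"
    by (simp_all add: canonical_graph_def)
  have "(\<exists>I. graph_isomorphism I id ?C G) \<longleftrightarrow>
      (\<forall>x \<in> ?\<Lambda> <+> ?\<Lambda>. \<forall>y \<in> ?\<Lambda> <+> ?\<Lambda>. endpoint ?C x = endpoint ?C y \<longleftrightarrow> endpoint G x = endpoint G y)"
    using isomorphic_over_arcs_iff[OF canonical_graph_no_isolated_vertices assms(1) arcs]
    by (simp only: arcs)
  also have "\<dots> \<longleftrightarrow> (\<forall>a\<in>?\<Lambda>. \<forall>b\<in>?\<Lambda>.
      (tail ?C a = tail ?C b \<longleftrightarrow> tail G a = tail G b) \<and>
      (head ?C a = head ?C b \<longleftrightarrow> head G a = head G b) \<and>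
      (tail ?C a = head ?C b \<longleftrightarrow> tail G a = head G b))"
    by (auto simp: Plus_def ball_Un eq_commute[of "head _ _" "tail _ _"])
  \<comment> \<open>The mixed coincidences are composability, which both graphs share.\<close>
  also have "\<dots> \<longleftrightarrow> (\<forall>a\<in>?\<Lambda>. \<forall>b\<in>?\<Lambda>.
      (tail ?C a = tail ?C b \<longleftrightarrow> tail G a = tail G b) \<and>
      (head ?C a = head ?C b \<longleftrightarrow> head G a = head G b))"
    by (simp add: tail head canonical_source_eq_range_iff)
  also have "\<dots> \<longleftrightarrow> R0 = same_source G \<and> R1 = same_range G"
    unfolding eq_same_source_iff[OF R0] eq_same_range_iff[OF R1] tail head
    by (auto simp: canonical_source_eq_iff[OF R0] canonical_range_eq_iff[OF R1])
  finally show ?thesis .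
qed

text \<open>Since \<open>ab\<close> has the source of \<open>b\<close>, also \<open>\<Lambda>\<^sup>a\<^sup>b = \<Lambda>\<^sup>b\<close>, so that
  \<open>v0 (ab)\<close> is a symbol whenever \<open>v0 b\<close> is; dually for \<open>v1\<close>.\<close>

lemma (in graphed_semigroupoid) mult_compatible_same_endpoints:
  "mult_compatible (composable G) mult (same_source G) (same_range G)"
proof -
  have "a \<in> arcs G" "b \<in> arcs G" if "(a, b) \<in> composable G" for a b
    using that by (auto simp: composable_def)
  then show ?thesis
    by (auto simp: mult_compatible_def same_source_def same_range_def
        mult_in_arcs tail_mult head_mult lcomp_composable rcomp_composable)
qed

theorem proposition2p17:
  fixes \<Lambda> :: "'a set"
    and comp :: "('a \<times> 'a) set"
    and mult :: "'a \<Rightarrow> 'a \<Rightarrow> 'a"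
    and G :: "('v, 'a) pre_digraph"
  assumes "categorical_exel_semigroupoid \<Lambda> comp mult"
    and "graphed_semigroupoid G mult"
    and "arcs G = \<Lambda>"
    and "comp = composable G"
    and "verts G = tail G ` \<Lambda> \<union> head G ` \<Lambda>"
  shows "\<exists>!(R0, R1). equiv (V0 \<Lambda> comp) R0 \<and> equiv (V1 \<Lambda> comp) R1 \<and>
    mult_compatible comp mult R0 R1 \<and>
    (\<exists>I. graph_isomorphism I id (canonical_graph \<Lambda> comp R0 R1) G)"
proof -
  have "no_isolated_vertices G"
    using assms(3,5) by (simp add: no_isolated_vertices_iff)
  note iso = canonical_graph_isomorphic_iff[OF this, unfolded assms(3) assms(4)[symmetric]]
  note equivs = equiv_same_source[of G, unfolded assms(3) assms(4)[symmetric]]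
    equiv_same_range[of G, unfolded assms(3) assms(4)[symmetric]]
  have compat: "mult_compatible comp mult (same_source G) (same_range G)"
    using graphed_semigroupoid.mult_compatible_same_endpoints[OF assms(2)] assms(4) by simp
  show ?thesis
  proof (rule ex1I[of _ "(same_source G, same_range G)"])
    show "case (same_source G, same_range G) of (R0, R1) \<Rightarrow>
        equiv (V0 \<Lambda> comp) R0 \<and> equiv (V1 \<Lambda> comp) R1 \<and> mult_compatible comp mult R0 R1 \<and>
        (\<exists>I. graph_isomorphism I id (canonical_graph \<Lambda> comp R0 R1) G)"
      using equivs compat iso by simp
  next
    fix R assume "case R of (R0, R1) \<Rightarrow>
        equiv (V0 \<Lambda> comp) R0 \<and> equiv (V1 \<Lambda> comp) R1 \<and> mult_compatible comp mult R0 R1 \<and>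
        (\<exists>I. graph_isomorphism I id (canonical_graph \<Lambda> comp R0 R1) G)"
    then show "R = (same_source G, same_range G)"
      using iso by (cases R) auto
  qed
qed

end
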